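(* Let $p$ be a prime with $p\equiv1\pmod 8$, $g$ a primitive root modulo $p$, $d=4$, $k=(p-1)/4$, $e_p(x)=e^{2\pi i x/p}$, and $\eta_a=\sum_{j=0}^{k-1}e_p(g^{4j+a})$. Let $V_4(p)=\sum_{s=0}^{3}|\eta_s|^4$. Let $M_{0,0,0}$ be the number of $\mathbb{F}_p$-rational points in $\mathbb{P}^2(\mathbb{F}_p)$ on the curve $x^4+y^4=z^4$, and define $t_0$ by $M_{0,0,0}=16t_0+12$. Then $$V_4(p)=\frac{1}{576}\Big(256pt_0^2-(32p^2+224p)t_0+p^3+167p^2-113p+9\Big).$$ Moreover, $$\frac{1}{64}(17p^2-18p+1)\le V_4(p)\le\frac{1}{64}(21p^2+24p^{3/2}+18p+1).$$ *)

theory Defs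
  imports Complex_Main "HOL-Number_Theory.Number_Theory"
begin

definition add_char :: "nat \<Rightarrow> nat \<Rightarrow> complex" where
  "add_char p x = exp (2 * of_real pi * \<i> * of_nat x / of_nat p)"

(* The Gauss period of order d, intended for d dividing p - 1 (so that "div" is exact). *)
definition gauss_period :: "nat \<Rightarrow> nat \<Rightarrow> nat \<Rightarrow> nat \<Rightarrow> complex" where
  "gauss_period d p g a = (\<Sum>j<(p - 1) div d. add_char p (g ^ (d * j + a)))"

definition V4 :: "nat \<Rightarrow> nat \<Rightarrow> real" where
  "V4 p g = (\<Sum>s<4. norm (gauss_period 4 p g s) ^ 4)"

(* Nonzero triples of homogeneous coordinates, and proportionality by a nonzero scalar;
   the ring R is intended to be a field. *)
definition hom_coords :: "('a, 'b) ring_scheme \<Rightarrow> ('a \<times> 'a \<times> 'a) set" where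
  "hom_coords R = carrier R \<times> carrier R \<times> carrier R - {(\<zero>\<^bsub>R\<^esub>, \<zero>\<^bsub>R\<^esub>, \<zero>\<^bsub>R\<^esub>)}"

definition proportional ::
    "('a, 'b) ring_scheme \<Rightarrow> (('a \<times> 'a \<times> 'a) \<times> ('a \<times> 'a \<times> 'a)) set" where
  "proportional R = {((x, y, z), (x', y', z')).
     (x, y, z) \<in> hom_coords R \<and> (x', y', z') \<in> hom_coords R \<and>
     (\<exists>c \<in> carrier R - {\<zero>\<^bsub>R\<^esub>}. x' = c \<otimes>\<^bsub>R\<^esub> x \<and> y' = c \<otimes>\<^bsub>R\<^esub> y \<and> z' = c \<otimes>\<^bsub>R\<^esub> z)}"

definition proj_plane :: "('a, 'b) ring_scheme \<Rightarrow> ('a \<times> 'a \<times> 'a) set set" where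
  "proj_plane R = hom_coords R // proportional R"

(* The equation is homogeneous, so it holds for all representatives of a point
   as soon as it holds for one of them. *)
definition fermat_quartic_points :: "('a, 'b) ring_scheme \<Rightarrow> ('a \<times> 'a \<times> 'a) set set" where
  "fermat_quartic_points R = {P \<in> proj_plane R. \<forall>(x, y, z) \<in> P.
     x [^]\<^bsub>R\<^esub> (4::nat) \<oplus>\<^bsub>R\<^esub> y [^]\<^bsub>R\<^esub> (4::nat) = z [^]\<^bsub>R\<^esub> (4::nat)}"

(* M_{0,0,0}, with the field of p elements realised as residue_ring p on {0..p-1}. *)
definition M000 :: "nat \<Rightarrow> nat" where
  "M000 p = card (fermat_quartic_points (residue_ring (int p)))"

end

theory Submission
  imports Defs "HOL-Analysis.Complex_Transcendental"
begin

text \<open>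
  The sums \<open>X\<^sub>a = (\<Sum>x<p. e(a x\<^sup>4))\<close> are real, and equal \<open>1 + 4 \<eta>\<^sub>s\<close> for \<open>a = g ^ s\<close>.
  Summing over all \<open>a\<close>, orthogonality turns their second and third moments into the number of
  solutions of \<open>x\<^sup>4 = y\<^sup>4\<close> and of \<open>x\<^sup>4 + y\<^sup>4 = z\<^sup>4\<close>; the second moment of the quadratic sums
  determines \<open>q = (X\<^sub>0 + X\<^sub>2) / 2 = - (X\<^sub>1 + X\<^sub>3) / 2\<close> up to sign, \<open>q\<^sup>2 = p\<close>.
  With \<open>A = (X\<^sub>0 - X\<^sub>2) / 4\<close> and \<open>B = (X\<^sub>1 - X\<^sub>3) / 4\<close> the quartic second moment says
  \<open>A\<^sup>2 + B\<^sup>2 = p\<close>, so that all symmetric functions of the four periods are polynomials in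
  \<open>p\<close> and \<open>s = (A\<^sup>2 - B\<^sup>2) / q\<close>, where \<open>\<bar>s\<bar> \<le> \<surd>p\<close>.
  The third moment is linear in \<open>s\<close> and identifies \<open>s\<close> with \<open>(M - p - 1) / 6\<close>, where \<open>M\<close> is
  the number of projective points of the Fermat quartic.
\<close>

section \<open>Block and periodic sums over initial segments of the naturals\<close>

lemma sum_lessThan_add_nat:
  fixes h :: "nat \<Rightarrow> 'a::comm_monoid_add"
  shows "(\<Sum>i<m + n. h i) = (\<Sum>i<m. h i) + (\<Sum>i<n. h (m + i))"
  by (induction n) (simp_all add: add.assoc)

lemma sum_lessThan_mult_nat:
  fixes h :: "nat \<Rightarrow> 'a::comm_monoid_add"
  shows "(\<Sum>i<n * k. h i) = (\<Sum>j<n. \<Sum>i<k. h (k * j + i))"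
proof (induction n)
  case (Suc n)
  have "(\<Sum>i<Suc n * k. h i) = (\<Sum>i<n * k + k. h i)" by (simp add: add.commute)
  also have "\<dots> = (\<Sum>i<n * k. h i) + (\<Sum>i<k. h (k * n + i))"
    by (simp only: sum_lessThan_add_nat mult.commute)
  finally show ?case using Suc by simp
qed simp

lemma sum_lessThan_periodic:
  fixes h :: "nat \<Rightarrow> 'a::comm_semiring_1"
  assumes "\<And>i. h (i + k) = h i"
  shows "(\<Sum>i<d * k. h i) = of_nat d * (\<Sum>i<k. h i)"
proof -
  have shift: "h (k * n + i) = h i" for n i
  proof (induction n)
    case (Suc n)
    then show ?case using assms[of "k * n + i"] by (simp add: algebra_simps)
  qed simp
  show ?thesis by (simp add: sum_lessThan_mult_nat shift)
qed

text \<open>Writing \<open>j\<close> as \<open>q * k + r mod k\<close> lets the quotient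
  \<open>q\<close> range freely over \<open>{..<d}\<close>. Later \<open>j\<close> is a discrete
  logarithm, and this counts the solutions of \<open>y ^ d = x ^ d\<close>.\<close>

lemma card_mod_eq:
  fixes k :: nat
  assumes "0 < k"
  shows "card {j \<in> {..<d * k}. j mod k = r mod k} = d"
proof -
  have "bij_betw (\<lambda>q. q * k + r mod k) {..<d} {j \<in> {..<d * k}. j mod k = r mod k}"
  proof (rule bij_betwI[where g = "\<lambda>j. j div k"])
    have "q * k + r mod k < d * k" if "q < d" for q
    proof -
      have "q * k + r mod k < Suc q * k" using assms by simp
      also have "\<dots> \<le> d * k" using that by (intro mult_le_mono1) simp
      finally show ?thesis .
    qed
    then show "(\<lambda>q. q * k + r mod k) \<in> {..<d} \<rightarrow> {j \<in> {..<d * k}. j mod k = r mod k}"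
      by auto
    show "(\<lambda>j. j div k) \<in> {j \<in> {..<d * k}. j mod k = r mod k} \<rightarrow> {..<d}"
      by (auto simp: less_mult_imp_div_less)
  next
    fix j assume "j \<in> {j \<in> {..<d * k}. j mod k = r mod k}"
    then have "r mod k = j mod k" by simp
    then show "j div k * k + r mod k = j" by (simp only: div_mult_mod_eq)
  qed (use assms in auto)
  then show ?thesis by (simp add: bij_betw_same_card[symmetric])
qed

section \<open>Additive characters modulo \<open>p\<close> and their orthogonality\<close>

lemma add_char_add: "add_char p (m + n) = add_char p m * add_char p n"
  by (simp add: add_char_def exp_add[symmetric] add_divide_distrib algebra_simps)

lemma add_char_mult: "add_char p (m * n) = add_char p n ^ m"
  by (simp add: add_char_def exp_of_nat_mult[symmetric] algebra_simps)

lemma add_char_0 [simp]: "add_char p 0 = 1"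
  by (simp add: add_char_def)

lemma norm_add_char [simp]: "norm (add_char p n) = 1"
proof -
  have "2 * of_real pi * \<i> * of_nat n / of_nat p
      = \<i> * complex_of_real (2 * pi * real n / real p)"
    by simp
  then show ?thesis unfolding add_char_def by (metis norm_exp_i_times)
qed

lemma add_char_mult_cnj [simp]: "add_char p n * cnj (add_char p n) = 1"
  by (simp add: complex_norm_square[symmetric])

lemma add_char_eq_iff:
  assumes "0 < p"
  shows "add_char p m = add_char p n \<longleftrightarrow> [m = n] (mod p)"
  using assms complex_root_unity_eq[of p m n]
  by (simp add: add_char_def cong_def mult.assoc)

lemma add_char_cong: "0 < p \<Longrightarrow> [m = n] (mod p) \<Longrightarrow> add_char p m = add_char p n"
  by (simp add: add_char_eq_iff)

text \<open>Both sides are the inverse of \<open>add_char p m\<close>: the left one because the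
  value has norm 1, the right one because the two arguments add up to 0.\<close>

lemma cnj_add_char:
  assumes "0 < p" "[m + n = 0] (mod p)"
  shows "cnj (add_char p m) = add_char p n"
proof -
  have "add_char p m * add_char p n = add_char p 0"
    using assms by (simp only: add_char_add[symmetric] add_char_eq_iff)
  moreover have "add_char p m \<noteq> 0" by (simp add: add_char_def)
  ultimately show ?thesis using add_char_mult_cnj[of p m]
    by (metis add_char_0 mult_cancel_left)
qed

text \<open>This is a geometric sum whose ratio \<open>w\<close> is a \<open>p\<close>-th root of
  unity, equal to 1 exactly in the congruent case. The conjugate stands in for the difference
  \<open>m - n\<close>, which would be truncated in the naturals.\<close>

lemma add_char_orthogonality:
  assumes "0 < p"
  shows "(\<Sum>a<p. add_char p (a * m) * cnj (add_char p (a * n)))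
       = (if [m = n] (mod p) then of_nat p else 0)"
proof -
  define w where "w = add_char p m * cnj (add_char p n)"
  have w_pow: "add_char p (a * m) * cnj (add_char p (a * n)) = w ^ a" for a
    by (simp add: w_def add_char_mult power_mult_distrib)
  have w_eq_1: "w = 1 \<longleftrightarrow> [m = n] (mod p)"
  proof -
    have "w = 1 \<longleftrightarrow> w * add_char p n = add_char p n"
      by (simp add: add_char_def)
    also have "w * add_char p n = add_char p m"
      by (simp add: w_def mult.assoc mult.commute[of "cnj _"])
    finally show ?thesis using assms by (simp add: add_char_eq_iff)
  qed
  have "w ^ p = 1"
  proof -
    have "add_char p (p * x) = 1" for x
      using assms add_char_cong[of p "p * x" 0] by (simp add: cong_0_iff)
    then show ?thesis by (simp add: w_pow[symmetric])
  qed
  then have "(\<Sum>a<p. w ^ a) = (if w = 1 then of_nat p else 0)"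
    using geometric_sum[of w p] by auto
  then show ?thesis by (simp add: w_pow w_eq_1)
qed

section \<open>Exponential sums over \<open>d\<close>-th powers and their moments as solution
  counts\<close>

text \<open>For \<open>d = 4\<close> these are the sums \<open>X_a\<close> of the overview; for
  \<open>d = 2\<close> they are the quadratic Gauss sums.\<close>

definition power_exp_sum :: "nat \<Rightarrow> nat \<Rightarrow> nat \<Rightarrow> complex" where
  "power_exp_sum p d a = (\<Sum>x<p. add_char p (a * x ^ d))"

text \<open>Expand the product and sum over \<open>a\<close> first: orthogonality keeps exactly the
  pairs with equal \<open>d\<close>-th powers, each with weight \<open>p\<close>.\<close>

lemma sum_norm_power_exp_sum:
  assumes "0 < p"
  shows "(\<Sum>a<p. power_exp_sum p d a * cnj (power_exp_sum p d a))
       = of_nat p * (\<Sum>x<p. of_nat (card {y \<in> {..<p}. [x ^ d = y ^ d] (mod p)}))"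
proof -
  have "(\<Sum>a<p. power_exp_sum p d a * cnj (power_exp_sum p d a))
      = (\<Sum>a<p. \<Sum>x<p. \<Sum>y<p. add_char p (a * x ^ d) * cnj (add_char p (a * y ^ d)))"
    by (simp add: power_exp_sum_def sum_product)
  also have "\<dots> = (\<Sum>x<p. \<Sum>y<p. \<Sum>a<p. add_char p (a * x ^ d) * cnj (add_char p (a * y ^ d)))"
    by (subst sum.swap, rule sum.cong[OF refl], rule sum.swap)
  also have "\<dots> = (\<Sum>x<p. \<Sum>y<p. if [x ^ d = y ^ d] (mod p) then of_nat p else 0)"
    using assms by (simp add: add_char_orthogonality)
  also have "\<dots> = of_nat p * (\<Sum>x<p. of_nat (card {y \<in> {..<p}. [x ^ d = y ^ d] (mod p)}))"
    by (simp add: sum.If_cases sum_distrib_left mult.commute Int_def)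
  finally show ?thesis .
qed

text \<open>Conjugating just one of the three factors moves its variable to the other side of the
  congruence, so orthogonality produces the Fermat equation. For real sums this is the ordinary
  third moment.\<close>

lemma sum_cube_power_exp_sum:
  assumes "0 < p"
  shows "(\<Sum>a<p. power_exp_sum p d a * power_exp_sum p d a * cnj (power_exp_sum p d a))
       = of_nat p * of_nat (card {(x, y, z). x < p \<and> y < p \<and> z < p \<and>
           [x ^ d + y ^ d = z ^ d] (mod p)})"
proof -
  let ?C = "{..<p} \<times> {..<p} \<times> {..<p}"
  have "(\<Sum>a<p. power_exp_sum p d a * power_exp_sum p d a * cnj (power_exp_sum p d a))
      = (\<Sum>a<p. power_exp_sum p d a * (power_exp_sum p d a * cnj (power_exp_sum p d a)))"
    by (simp only: mult.assoc)
  also have "\<dots> = (\<Sum>a<p. \<Sum>x<p. \<Sum>y<p. \<Sum>z<p.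
          add_char p (a * (x ^ d + y ^ d)) * cnj (add_char p (a * z ^ d)))"
    by (simp only: power_exp_sum_def cnj_sum sum_product)
      (simp add: sum_distrib_left add_char_add distrib_left mult.assoc)
  also have "\<dots> = (\<Sum>a<p. \<Sum>(x, y, z)\<in>?C.
          add_char p (a * (x ^ d + y ^ d)) * cnj (add_char p (a * z ^ d)))"
    by (simp add: sum.cartesian_product)
  also have "\<dots> = (\<Sum>(x, y, z)\<in>?C. \<Sum>a<p.
          add_char p (a * (x ^ d + y ^ d)) * cnj (add_char p (a * z ^ d)))"
    by (subst sum.swap) (simp add: case_prod_unfold)
  also have "\<dots> = (\<Sum>v\<in>?C. if (case v of (x, y, z) \<Rightarrow> [x ^ d + y ^ d = z ^ d] (mod p))
      then of_nat p else 0)"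
    using assms by (simp add: add_char_orthogonality case_prod_unfold)
  also have "\<dots> = of_nat p * of_nat (card {v \<in> ?C.
      (case v of (x, y, z) \<Rightarrow> [x ^ d + y ^ d = z ^ d] (mod p))})"
    by (simp add: sum.If_cases mult.commute Int_def)
  also have "{v \<in> ?C. (case v of (x, y, z) \<Rightarrow> [x ^ d + y ^ d = z ^ d] (mod p))}
      = {(x, y, z). x < p \<and> y < p \<and> z < p \<and> [x ^ d + y ^ d = z ^ d] (mod p)}"
    by auto
  finally show ?thesis .
qed

section \<open>Gauss periods through a primitive root\<close>

context
  fixes p g :: nat
  assumes prime_p: "prime p" and primroot: "residue_primroot p g"
begin

lemma p_pos: "0 < p"
  using prime_p by (simp add: prime_gt_0_nat)

lemma primroot_pow_cong_iff: "[g ^ m = g ^ n] (mod p) \<longleftrightarrow> [m = n] (mod (p - 1))"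
  using primroot prime_p order_divides_expdiff[of p g m n]
  by (simp add: residue_primroot_def totient_prime)

lemma sum_residues_primroot:
  "(\<Sum>x<p. h x) = h 0 + (\<Sum>i<p - 1. h (g ^ i mod p))"
  for h :: "nat \<Rightarrow> 'a::comm_monoid_add"
proof -
  have "1 < p" using prime_p prime_gt_1_nat by blast
  then have bij: "bij_betw (\<lambda>i. g ^ i mod p) {..<p - 1} {0<..<p}"
    using residue_primroot_is_generator[OF _ primroot] prime_p
    by (simp add: totient_prime totatives_prime)
  have "{..<p} = insert 0 {0<..<p}" using p_pos by auto
  then have "(\<Sum>x<p. h x) = h 0 + (\<Sum>x\<in>{0<..<p}. h x)" by simp
  also have "(\<Sum>x\<in>{0<..<p}. h x) = (\<Sum>i<p - 1. h (g ^ i mod p))"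
    by (rule sum.reindex_bij_betw[OF bij, symmetric])
  finally show ?thesis .
qed

lemma power_exp_sum_cong:
  "[a = b] (mod p) \<Longrightarrow> power_exp_sum p d a = power_exp_sum p d b"
  unfolding power_exp_sum_def
  by (intro sum.cong refl add_char_cong p_pos cong_mult) auto

text \<open>The term \<open>x = 0\<close> contributes 1. For \<open>x = g ^ j\<close> the summand
  depends only on \<open>j\<close> modulo \<open>(p - 1) div d\<close>, so the remaining terms run
  \<open>d\<close> times through the period.\<close>

lemma power_exp_sum_primroot:
  assumes "d dvd p - 1" "0 < d"
  shows "power_exp_sum p d (g ^ i) = 1 + of_nat d * gauss_period d p g i"
proof -
  define k where "k = (p - 1) div d"
  have dk: "p - 1 = d * k" using assms by (simp add: k_def)
  have "power_exp_sum p d (g ^ i)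
      = 1 + (\<Sum>j<p - 1. add_char p (g ^ i * (g ^ j mod p) ^ d))"
    using assms by (simp add: power_exp_sum_def sum_residues_primroot power_0_left)
  also have "(\<Sum>j<p - 1. add_char p (g ^ i * (g ^ j mod p) ^ d))
      = (\<Sum>j<p - 1. add_char p (g ^ (d * j + i)))"
  proof (intro sum.cong refl add_char_cong p_pos)
    fix j
    have "[g ^ i * (g ^ j mod p) ^ d = g ^ i * (g ^ j) ^ d] (mod p)"
      by (intro cong_mult cong_pow) auto
    then show "[g ^ i * (g ^ j mod p) ^ d = g ^ (d * j + i)] (mod p)"
      by (simp add: power_add power_mult[symmetric] mult.commute)
  qed
  also have "(\<Sum>j<p - 1. add_char p (g ^ (d * j + i)))
      = of_nat d * (\<Sum>j<k. add_char p (g ^ (d * j + i)))"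
    unfolding dk
  proof (rule sum_lessThan_periodic)
    fix j
    have "[d * (j + k) + i = d * j + i] (mod (p - 1))"
      using mod_add_self2[of "d * j + i" "d * k"]
      by (simp only: dk cong_def distrib_left ac_simps)
    then show "add_char p (g ^ (d * (j + k) + i)) = add_char p (g ^ (d * j + i))"
      by (intro add_char_cong p_pos) (simp add: primroot_pow_cong_iff)
  qed
  finally show ?thesis by (simp add: gauss_period_def k_def)
qed

text \<open>Raising the index by \<open>d\<close> shifts the summation variable by one; the shift is
  cyclic because the exponents of the terms \<open>k\<close> and \<open>0\<close> differ by
  \<open>p - 1\<close>.\<close>

lemma gauss_period_periodic:
  assumes "d dvd p - 1"
  shows "gauss_period d p g (i + d * m) = gauss_period d p g i"
proof -
  define k where "k = (p - 1) div d"
  have dk: "p - 1 = d * k" using assms by (simp add: k_def)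
  have step: "gauss_period d p g (i + d) = gauss_period d p g i" for i
  proof -
    define h where "h j = add_char p (g ^ (d * j + i))" for j
    have "[d * k + i = d * 0 + i] (mod (p - 1))"
      unfolding dk cong_def by simp
    then have "h k = h 0"
      unfolding h_def by (intro add_char_cong p_pos) (simp add: primroot_pow_cong_iff)
    have "gauss_period d p g (i + d) = (\<Sum>j<k. h (Suc j))"
      by (simp add: gauss_period_def h_def k_def algebra_simps)
    also have "\<dots> = (\<Sum>j<k. h j)"
      using sum.lessThan_Suc_shift[of h k] \<open>h k = h 0\<close> by (simp add: add.commute)
    finally show ?thesis by (simp add: gauss_period_def h_def k_def)
  qed
  show ?thesis
  proof (induction m)
    case (Suc m)
    then show ?case using step[of "i + d * m"] by (simp add: algebra_simps)
  qed simp
qed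

text \<open>Here \<open>a = 0\<close> gives the value \<open>p\<close>, and \<open>a = g ^ i\<close>
  gives a term of period \<open>d\<close> in \<open>i\<close>. With \<open>F\<close> arbitrary, one
  statement serves every moment.\<close>

lemma sum_power_exp_sum_primroot:
  fixes F :: "complex \<Rightarrow> complex"
  assumes "d dvd p - 1" "0 < d"
  shows "(\<Sum>a<p. F (power_exp_sum p d a))
    = F (of_nat p) + of_nat ((p - 1) div d) * (\<Sum>s<d. F (1 + of_nat d * gauss_period d p g s))"
proof -
  have pd: "p - 1 = (p - 1) div d * d" using assms by simp
  have "(\<Sum>a<p. F (power_exp_sum p d a))
      = F (of_nat p) + (\<Sum>i<p - 1. F (power_exp_sum p d (g ^ i mod p)))"
    by (subst sum_residues_primroot) (simp add: power_exp_sum_def)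
  also have "(\<Sum>i<p - 1. F (power_exp_sum p d (g ^ i mod p)))
      = (\<Sum>i<p - 1. F (1 + of_nat d * gauss_period d p g i))"
  proof (intro sum.cong refl)
    fix i
    have "power_exp_sum p d (g ^ i mod p) = power_exp_sum p d (g ^ i)"
      by (rule power_exp_sum_cong) simp
    then show "F (power_exp_sum p d (g ^ i mod p)) = F (1 + of_nat d * gauss_period d p g i)"
      by (simp add: power_exp_sum_primroot[OF assms])
  qed
  also have "(\<Sum>i<p - 1. F (1 + of_nat d * gauss_period d p g i))
      = of_nat ((p - 1) div d) * (\<Sum>s<d. F (1 + of_nat d * gauss_period d p g s))"
    using sum_lessThan_periodic
      [of "\<lambda>i. F (1 + of_nat d * gauss_period d p g i)" d "(p - 1) div d"]
      gauss_period_periodic[OF assms(1), of _ 1] pd by simp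
  finally show ?thesis .
qed

lemma primroot_half_pow:
  assumes "even (p - 1)"
  shows "[g ^ ((p - 1) div 2) + 1 = 0] (mod p)"
proof -
  \<comment> \<open>Over the integers \<open>w * w - 1\<close> factors as
    \<open>(w - 1) * (w + 1)\<close>, and the order of \<open>g\<close> excludes the first
    factor.\<close>
  define w where "w = int (g ^ ((p - 1) div 2))"
  \<comment> \<open>Evenness of \<open>p - 1\<close> rules out \<open>p = 2\<close>, so half of
    \<open>p - 1\<close> lies strictly between 0 and \<open>p - 1\<close>.\<close>
  have "2 \<le> p" using prime_p by (rule prime_ge_2_nat)
  then have "2 \<le> p - 1" using assms by (cases "p = 2") auto
  then have ndvd: "\<not> [(p - 1) div 2 = 0] (mod (p - 1))"
    by (simp add: cong_def)
  have "[g ^ (p - 1) = g ^ 0] (mod p)"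
    by (subst primroot_pow_cong_iff) (simp add: cong_def)
  moreover have "g ^ (p - 1) = g ^ ((p - 1) div 2) * g ^ ((p - 1) div 2)"
    using assms by (metis dvd_mult_div_cancel mult_2 power_add)
  ultimately have "[w * w = 1] (mod int p)"
    unfolding w_def by (metis cong_int_iff of_nat_1 of_nat_mult power_0)
  then have "int p dvd (w - 1) * (w + 1)"
    by (simp add: cong_iff_dvd_diff algebra_simps)
  moreover have "\<not> int p dvd w - 1"
  proof
    assume "int p dvd w - 1"
    then have "[int (g ^ ((p - 1) div 2)) = int (g ^ 0)] (mod int p)"
      by (simp add: cong_iff_dvd_diff w_def)
    then show False using ndvd by (simp only: cong_int_iff primroot_pow_cong_iff)
  qed
  ultimately have "int p dvd w + 1"
    using prime_p by (auto simp: prime_dvd_mult_iff)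
  then have "int p dvd int (g ^ ((p - 1) div 2) + 1)"
    by (simp add: w_def add.commute)
  then show ?thesis by (simp only: of_nat_dvd_iff cong_0_iff)
qed

text \<open>Since -1 is the power of \<open>g\<close> with exponent \<open>(p - 1) div 2\<close>,
  conjugation shifts the index by that exponent, which is a multiple of \<open>d\<close> by
  hypothesis. For \<open>d = 4\<close> this is where 8 dividing \<open>p - 1\<close> is
  needed.\<close>

lemma cnj_gauss_period:
  assumes "2 * d dvd p - 1"
  shows "cnj (gauss_period d p g i) = gauss_period d p g i"
proof -
  obtain m where m: "p - 1 = 2 * d * m" using assms by auto
  have half: "(p - 1) div 2 = d * m" using m by simp
  have "cnj (add_char p (g ^ n)) = add_char p (g ^ (n + d * m))" for n
  proof (rule cnj_add_char[OF p_pos])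
    have "even (p - 1)" using m by simp
    then have "[g ^ (d * m) + 1 = 0] (mod p)"
      using primroot_half_pow by (simp only: half)
    then have "[g ^ n * (g ^ (d * m) + 1) = g ^ n * 0] (mod p)"
      by (intro cong_mult cong_refl)
    then show "[g ^ n + g ^ (n + d * m) = 0] (mod p)"
      by (simp add: power_add algebra_simps)
  qed
  then have "cnj (gauss_period d p g i) = gauss_period d p g (i + d * m)"
    by (simp add: gauss_period_def add.assoc)
  then show ?thesis using gauss_period_periodic[of d i m] assms
    by (metis dvd_mult_right)
qed

text \<open>For \<open>x = 0\<close> only \<open>y = 0\<close> qualifies. For
  \<open>x = g ^ i\<close> the solutions are the \<open>g ^ j\<close> with \<open>d * j\<close>
  congruent to \<open>d * i\<close> modulo \<open>p - 1\<close>, and there are \<open>d\<close> such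
  exponents.\<close>

lemma sum_card_equal_powers:
  assumes "d dvd p - 1" "0 < d"
  shows "(\<Sum>x<p. card {y \<in> {..<p}. [x ^ d = y ^ d] (mod p)}) = 1 + (p - 1) * d"
proof -
  define k where "k = (p - 1) div d"
  have dk: "p - 1 = d * k" using assms by (simp add: k_def)
  have "1 < p" using prime_p prime_gt_1_nat by blast
  then have "0 < k" using dk by (cases k) auto
  have card_sum: "card {y \<in> {..<p}. Q y} = (\<Sum>y<p. if Q y then 1 else 0)" for Q
    by (simp add: sum.If_cases Int_def)
  \<comment> \<open>Powers of \<open>g\<close> are never 0 modulo \<open>p\<close>, so zero and
    nonzero residues do not mix in the counts.\<close>
  have dvd_pow: "p dvd (g ^ i mod p) ^ d \<longleftrightarrow> False" for i
  proof -
    have "coprime p g" using primroot by (simp add: residue_primroot_def)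
    then have "\<not> p dvd g" using \<open>1 < p\<close> by (metis coprime_common_divisor_nat dvd_refl less_irrefl)
    then have "\<not> p dvd g ^ i mod p"
      using prime_p by (metis dvd_mod_iff dvd_refl prime_dvd_power)
    then show ?thesis using prime_p prime_dvd_power by blast
  qed
  have "(\<Sum>y<p. if [0 ^ d = y ^ d] (mod p) then 1 else 0) = (1::nat)"
    using assms by (subst sum_residues_primroot)
      (simp add: power_0_left cong_sym_eq[of 0] cong_0_iff dvd_pow)
  moreover have "(\<Sum>y<p. if [(g ^ i mod p) ^ d = y ^ d] (mod p) then 1 else 0) = d" for i
  proof -
    have iff: "[(g ^ i mod p) ^ d = (g ^ j mod p) ^ d] (mod p) \<longleftrightarrow> j mod k = i mod k" for j
    proof -
      have "[(g ^ i mod p) ^ d = (g ^ j mod p) ^ d] (mod p) \<longleftrightarrow> [g ^ (d * i) = g ^ (d * j)] (mod p)"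
        by (simp add: cong_def power_mod power_mult[symmetric] mult.commute)
      also have "\<dots> \<longleftrightarrow> d * i mod (d * k) = d * j mod (d * k)"
        by (simp only: primroot_pow_cong_iff) (simp only: cong_def dk)
      also have "\<dots> \<longleftrightarrow> j mod k = i mod k"
        using assms by (auto simp: mult_mod_right[symmetric])
      finally show ?thesis .
    qed
    have "(\<Sum>y<p. if [(g ^ i mod p) ^ d = y ^ d] (mod p) then 1 else 0)
        = (\<Sum>j<d * k. if j mod k = i mod k then 1 else (0::nat))"
      using assms dvd_pow[of i] unfolding dk[symmetric] iff[symmetric]
      by (subst sum_residues_primroot) (simp add: power_0_left cong_0_iff)
    also have "\<dots> = card {j \<in> {..<d * k}. j mod k = i mod k}"
      by (simp add: sum.If_cases Int_def)
    also have "\<dots> = d" by (rule card_mod_eq[OF \<open>0 < k\<close>])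
    finally show ?thesis .
  qed
  ultimately show ?thesis
    unfolding card_sum by (subst sum_residues_primroot) simp
qed

text \<open>The second moment is evaluated both by counting and through the periods, which are real.
  Removing the contribution \<open>p * p\<close> of \<open>a = 0\<close> and cancelling
  \<open>k\<close> leaves the claim.\<close>

lemma sum_square_gauss_periods:
  assumes "2 * d dvd p - 1" "0 < d"
  shows "(\<Sum>s<d. (1 + of_nat d * gauss_period d p g s) ^ 2) = of_nat (d * (d - 1) * p)"
proof -
  obtain m where m: "p - 1 = 2 * d * m" using assms by auto
  define k where "k = (p - 1) div d"
  have d: "d dvd p - 1" using assms(1) by (rule dvd_mult_right)
  have dk: "p - 1 = d * k" using d by (simp add: k_def)
  have "1 < p" using prime_p prime_gt_1_nat by blast
  then have "0 < k" using dk by (cases k) auto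
  have p: "of_nat p = 1 + of_nat d * (of_nat k :: complex)"
    using dk \<open>1 < p\<close> by (metis of_nat_1 of_nat_add of_nat_mult le_add_diff_inverse less_imp_le)
  have "of_nat p * of_nat (1 + (p - 1) * d)
      = of_nat p * of_nat p + of_nat k * (\<Sum>s<d. (1 + of_nat d * gauss_period d p g s) ^ 2)"
    using sum_norm_power_exp_sum[OF p_pos, of d] sum_power_exp_sum_primroot[OF d assms(2),
        of "\<lambda>z. z * cnj z"] sum_card_equal_powers[OF d assms(2)]
    by (simp add: cnj_gauss_period[OF assms(1)] k_def power2_eq_square of_nat_sum[symmetric]
        del: of_nat_sum)
  then have "of_nat k * (\<Sum>s<d. (1 + of_nat d * gauss_period d p g s) ^ 2)
      = of_nat k * (of_nat d * (of_nat d - 1) * (of_nat p :: complex))"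
    unfolding dk of_nat_add of_nat_mult by (simp add: p algebra_simps)
  then show ?thesis using \<open>0 < k\<close> assms(2) by (simp add: of_nat_diff)
qed

text \<open>Together the periods cover every nonzero residue once, and the sum of the character over
  all residues vanishes.\<close>

lemma sum_gauss_periods:
  assumes "d dvd p - 1"
  shows "(\<Sum>s<d. gauss_period d p g s) = -1"
proof -
  define k where "k = (p - 1) div d"
  have dk: "k * d = p - 1" using assms by (simp add: k_def)
  have "1 < p" using prime_p prime_gt_1_nat by blast
  then have "\<not> [1 = 0] (mod p)" by (simp add: cong_def)
  then have "(\<Sum>x<p. add_char p x) = 0"
    using add_char_orthogonality[OF p_pos, of 1 0] by simp
  moreover have "add_char p (g ^ i mod p) = add_char p (g ^ i)" for i
    by (intro add_char_cong p_pos) simp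
  ultimately have "(\<Sum>i<p - 1. add_char p (g ^ i)) = -1"
    by (subst (asm) sum_residues_primroot) (simp add: eq_neg_iff_add_eq_0 add.commute)
  then have "(\<Sum>j<k. \<Sum>s<d. add_char p (g ^ (d * j + s))) = -1"
    by (simp only: dk[symmetric] sum_lessThan_mult_nat)
  then show ?thesis
    unfolding gauss_period_def k_def[symmetric] by (subst sum.swap)
qed

end

text \<open>Split the summation variable by parity. This expresses the quadratic periods through the
  quartic ones.\<close>

lemma gauss_period_double:
  assumes "2 * d dvd p - 1"
  shows "gauss_period d p g i = gauss_period (2 * d) p g i + gauss_period (2 * d) p g (i + d)"
proof (cases "d = 0")
  case False
  obtain m where m: "p - 1 = 2 * d * m" using assms by auto
  have div_d: "(p - 1) div d = m * 2" and div_2d: "(p - 1) div (2 * d) = m"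
    using False by (simp_all only: m) simp_all
  have "gauss_period d p g i = (\<Sum>j<m * 2. add_char p (g ^ (d * j + i)))"
    by (simp only: gauss_period_def div_d)
  also have "\<dots> = (\<Sum>j<m. add_char p (g ^ (2 * d * j + i)) + add_char p (g ^ (2 * d * j + (i + d))))"
    by (simp only: sum_lessThan_mult_nat) (simp add: numeral_2_eq_2 algebra_simps)
  finally show ?thesis by (simp only: gauss_period_def div_2d sum.distrib)
\<comment> \<open>For \<open>d = 0\<close> division by zero yields 0, so all three sums are
  empty.\<close>
qed (simp add: gauss_period_def)

section \<open>From projective points to affine solutions\<close>

text \<open>The nonzero scalars act freely on nonzero triples, so each projective point is a class
  of \<open>card (carrier R) - 1\<close> triples. The nonzero solutions are the disjoint union of
  the classes on the curve.\<close>

lemma (in field) card_fermat_quartic_points: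
  assumes fin: "finite (carrier R)"
  shows "(card (carrier R) - 1) * card (fermat_quartic_points R)
       = card {(x, y, z) \<in> hom_coords R. x [^] (4::nat) \<oplus> y [^] (4::nat) = z [^] (4::nat)}"
proof -
  define scale where "scale = (\<lambda>c (x, y, z). (c \<otimes> x, c \<otimes> y, c \<otimes> z))"
  define W where
    "W = {(x, y, z) \<in> hom_coords R. x [^] (4::nat) \<oplus> y [^] (4::nat) = z [^] (4::nat)}"
  have scale_hom: "scale c v \<in> hom_coords R"
    if "c \<in> carrier R - {\<zero>}" "v \<in> hom_coords R" for c v
    using that by (auto simp: scale_def hom_coords_def integral_iff)
  have class_eq: "proportional R `` {v} = (\<lambda>c. scale c v) ` (carrier R - {\<zero>})"
    if "v \<in> hom_coords R" for v
    using that scale_hom[OF _ that] by (auto simp: proportional_def scale_def image_iff)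
  have proportional_iff: "(v, w) \<in> proportional R \<longleftrightarrow>
      v \<in> hom_coords R \<and> w \<in> hom_coords R \<and> (\<exists>c\<in>carrier R - {\<zero>}. w = scale c v)" for v w
    by (auto simp: proportional_def scale_def)
  have equiv: "equiv (hom_coords R) (proportional R)"
  proof (rule equivI)
    show "proportional R \<subseteq> hom_coords R \<times> hom_coords R"
      by (auto simp: proportional_def)
    show "refl_on (hom_coords R) (proportional R)"
      by (auto simp: refl_on_def proportional_def hom_coords_def intro!: bexI[of _ \<one>])
    show "sym (proportional R)"
    proof (rule symI)
      fix v w assume "(v, w) \<in> proportional R"
      then obtain c where v: "v \<in> hom_coords R" and w: "w \<in> hom_coords R"
        and c: "c \<in> carrier R - {\<zero>}" "w = scale c v"
        by (auto simp: proportional_iff)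
      then have "c \<in> Units R" by (simp add: field_Units)
      then have "inv c \<in> carrier R - {\<zero>}" "v = scale (inv c) w"
        using c v Units_inv_Units[of c]
        by (auto simp: field_Units scale_def hom_coords_def m_assoc[symmetric])
      then show "(w, v) \<in> proportional R"
        using v w by (auto simp: proportional_iff)
    qed
    show "trans (proportional R)"
    proof (rule transI)
      fix u v w assume "(u, v) \<in> proportional R" "(v, w) \<in> proportional R"
      then obtain c c' where "u \<in> hom_coords R" "w \<in> hom_coords R"
        and "c \<in> carrier R - {\<zero>}" "v = scale c u" "c' \<in> carrier R - {\<zero>}" "w = scale c' v"
        by (auto simp: proportional_iff)
      moreover from this have "c' \<otimes> c \<in> carrier R - {\<zero>}" "w = scale (c' \<otimes> c) u"
        by (auto simp: scale_def hom_coords_def m_assoc integral_iff)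
      ultimately show "(u, w) \<in> proportional R"
        unfolding proportional_iff by blast
    qed
  qed
  \<comment> \<open>By homogeneity a class meeting \<open>W\<close> lies inside
    \<open>W\<close>.\<close>
  have scale_W: "scale c v \<in> W" if "c \<in> carrier R - {\<zero>}" "v \<in> W" for c v
  proof -
    obtain x y z where v: "v = (x, y, z)" by (cases v)
    with that have xyz: "x \<in> carrier R" "y \<in> carrier R" "z \<in> carrier R"
      and eq: "x [^] (4::nat) \<oplus> y [^] (4::nat) = z [^] (4::nat)" and hom: "v \<in> hom_coords R"
      by (auto simp: W_def hom_coords_def)
    have "(c \<otimes> x) [^] (4::nat) \<oplus> (c \<otimes> y) [^] (4::nat)
        = c [^] (4::nat) \<otimes> (x [^] (4::nat) \<oplus> y [^] (4::nat))"
      using that xyz by (simp add: nat_pow_distrib r_distr)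
    also have "\<dots> = (c \<otimes> z) [^] (4::nat)"
      using that xyz by (simp add: eq nat_pow_distrib)
    finally show ?thesis using scale_hom[OF that(1) hom] by (simp add: W_def v scale_def)
  qed
  have points: "fermat_quartic_points R = {P \<in> proj_plane R. P \<subseteq> W}"
  proof -
    have "P \<subseteq> hom_coords R" if "P \<in> proj_plane R" for P
      using that in_quotient_imp_subset[OF equiv] by (simp add: proj_plane_def)
    then show ?thesis by (auto simp: fermat_quartic_points_def W_def)
  qed
  have union: "\<Union>(fermat_quartic_points R) = W"
  proof
    show "W \<subseteq> \<Union>(fermat_quartic_points R)"
    proof
      fix v assume v: "v \<in> W"
      then have hom: "v \<in> hom_coords R" by (auto simp: W_def)
      then have "proportional R `` {v} \<in> proj_plane R"
        by (simp add: proj_plane_def quotientI)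
      moreover have "proportional R `` {v} \<subseteq> W"
        unfolding class_eq[OF hom] using scale_W v by blast
      ultimately have "proportional R `` {v} \<in> fermat_quartic_points R"
        by (simp add: points)
      moreover have "v \<in> proportional R `` {v}"
        using equiv hom by (rule equiv_class_self)
      ultimately show "v \<in> \<Union>(fermat_quartic_points R)" by blast
    qed
  qed (auto simp: points)
  have fin_hom: "finite (hom_coords R)" using fin by (simp add: hom_coords_def)
  have "(card (carrier R) - 1) * card (fermat_quartic_points R)
      = card (\<Union>(fermat_quartic_points R))"
  proof (rule card_partition)
    show "finite (fermat_quartic_points R)"
      using fin_hom by (simp add: points proj_plane_def equiv finite_quotient equiv_type)
    show "finite (\<Union>(fermat_quartic_points R))"
      unfolding union using fin_hom by (rule rev_finite_subset) (auto simp: W_def)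
    show "P \<inter> Q = {}"
      if "P \<in> fermat_quartic_points R" "Q \<in> fermat_quartic_points R" "P \<noteq> Q" for P Q
      using that quotient_disj[OF equiv] by (auto simp: points proj_plane_def)
    show "card P = card (carrier R) - 1" if "P \<in> fermat_quartic_points R" for P
    proof -
      from that obtain v where v: "v \<in> hom_coords R" "P = proportional R `` {v}"
        by (auto simp: points proj_plane_def elim: quotientE)
      \<comment> \<open>Some coordinate of \<open>v\<close> is nonzero and can be cancelled.\<close>
      have "inj_on (\<lambda>c. scale c v) (carrier R - {\<zero>})"
        using v by (auto simp: inj_on_def scale_def hom_coords_def) (metis m_rcancel)+
      then show ?thesis using v fin by (simp add: class_eq card_image)
    qed
  qed
  then show ?thesis by (simp only: union W_def)
qed

text \<open>The summand 1 is the zero triple, which solves the congruence but represents no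
  projective point.\<close>

lemma M000_eq_affine_count:
  assumes "prime p"
  shows "(p - 1) * M000 p + 1
       = card {(x, y, z). x < p \<and> y < p \<and> z < p \<and> [x ^ 4 + y ^ 4 = z ^ 4] (mod p)}"
proof -
  define R where "R = residue_ring (int p)"
  interpret residues_prime p R
    using assms by unfold_locales (auto simp: R_def)
  interpret field R by (rule is_field)
  define A where "A = {(x, y, z). x < p \<and> y < p \<and> z < p \<and> [x ^ 4 + y ^ 4 = z ^ 4] (mod p)}"
  define W where
    "W = {(x, y, z) \<in> hom_coords R. x [^]\<^bsub>R\<^esub> (4::nat) \<oplus>\<^bsub>R\<^esub> y [^]\<^bsub>R\<^esub> (4::nat) = z [^]\<^bsub>R\<^esub> (4::nat)}"
  have p_gt_1: "1 < p" using assms prime_gt_1_nat by blast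
  have pow: "x [^]\<^bsub>R\<^esub> (4::nat) = x ^ 4 mod int p" if "x \<in> carrier R" for x
    using pow_cong[of x 4] that by (simp add: res_carrier_eq)
  have W_iff: "(int x, int y, int z) \<in> W \<longleftrightarrow> (x, y, z) \<in> A - {(0, 0, 0)}" for x y z
  proof -
    have "int x ^ 4 mod int p \<oplus>\<^bsub>R\<^esub> int y ^ 4 mod int p = int z ^ 4 mod int p
        \<longleftrightarrow> [int (x ^ 4 + y ^ 4) = int (z ^ 4)] (mod int p)"
      by (simp add: add_cong cong_def)
    then show ?thesis
      by (auto simp: W_def A_def hom_coords_def pow cong_int_iff res_carrier_eq zero_cong
          res_zero_eq simp del: of_nat_add of_nat_power)
  qed
  have "bij_betw (\<lambda>(x, y, z). (int x, int y, int z)) (A - {(0, 0, 0)}) W"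
    unfolding bij_betw_def
  proof
    show "inj_on (\<lambda>(x, y, z). (int x, int y, int z)) (A - {(0, 0, 0)})"
      by (auto simp: inj_on_def)
    show "(\<lambda>(x, y, z). (int x, int y, int z)) ` (A - {(0, 0, 0)}) = W"
    proof
      show "W \<subseteq> (\<lambda>(x, y, z). (int x, int y, int z)) ` (A - {(0, 0, 0)})"
      proof
        fix v assume v: "v \<in> W"
        then obtain x y z where xyz: "v = (int x, int y, int z)"
          by (auto simp: W_def hom_coords_def res_carrier_eq elim!: nonneg_int_cases)
        with v have "(x, y, z) \<in> A - {(0, 0, 0)}" by (simp only: W_iff)
        then show "v \<in> (\<lambda>(x, y, z). (int x, int y, int z)) ` (A - {(0, 0, 0)})"
          by (rule rev_image_eqI) (simp add: xyz)
      qed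
    qed (use W_iff in auto)
  qed
  then have "card W = card (A - {(0, 0, 0)})" by (simp add: bij_betw_same_card)
  moreover have "(p - 1) * M000 p = card W"
    using card_fermat_quartic_points by (simp add: M000_def R_def[symmetric] W_def res_carrier_eq)
  moreover have "finite A"
    by (rule finite_subset[of _ "{..<p} \<times> {..<p} \<times> {..<p}"]) (auto simp: A_def)
  moreover have "(0, 0, 0) \<in> A" using p_gt_1 by (simp add: A_def)
  ultimately show ?thesis
    by (metis A_def Suc_eq_plus1 card.remove)
qed

section \<open>Real algebra of the four periods\<close>

lemma fourth_moment_of_periods:
  fixes p M :: real and r :: "nat \<Rightarrow> real"
  assumes "0 < p" "p \<noteq> 1"
    and sum1: "r 0 + r 1 + r 2 + r 3 = -1"
    and quad: "(1 + 2 * (r 0 + r 2)) ^ 2 + (1 + 2 * (r 1 + r 3)) ^ 2 = 2 * p"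
    and sum2: "(1 + 4 * r 0) ^ 2 + (1 + 4 * r 1) ^ 2 + (1 + 4 * r 2) ^ 2 + (1 + 4 * r 3) ^ 2 = 12 * p"
    and sum3: "p * ((p - 1) * M + 1) = p ^ 3 + (p - 1) / 4 *
        ((1 + 4 * r 0) ^ 3 + (1 + 4 * r 1) ^ 3 + (1 + 4 * r 2) ^ 3 + (1 + 4 * r 3) ^ 3)"
  obtains s where "M = p + 1 + 6 * s" "s ^ 2 \<le> p"
    "64 * (r 0 ^ 4 + r 1 ^ 4 + r 2 ^ 4 + r 3 ^ 4) = 17 * p ^ 2 + 4 * p * s ^ 2 - 24 * p * s + 18 * p + 1"
proof -
  define q where "q = 1 + 2 * (r 0 + r 2)"
  define A where "A = r 0 - r 2"
  define B where "B = r 1 - r 3"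
  \<comment> \<open>Dividing by \<open>q\<close> makes the argument independent of the sign of
    \<open>q\<close>, which is known only through its square.\<close>
  define s where "s = (A ^ 2 - B ^ 2) / q"
  have "1 + 2 * (r 1 + r 3) = - q" using sum1 by (simp add: q_def)
  then have "q ^ 2 + (- q) ^ 2 = 2 * p" using quad by (simp only: q_def)
  then have q2: "q ^ 2 = p" by simp
  then have "q \<noteq> 0" using assms(1) by auto
  have r: "r 0 = (q - 1) / 4 + A / 2" "r 2 = (q - 1) / 4 - A / 2"
    "r 1 = (- q - 1) / 4 + B / 2" "r 3 = (- q - 1) / 4 - B / 2"
    using sum1 by (auto simp: q_def A_def B_def field_simps)
  have AB: "A ^ 2 + B ^ 2 = p"
    using sum2 unfolding r q2[symmetric] by (simp add: power2_eq_square field_simps)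
  have W: "A ^ 2 - B ^ 2 = q * s" using \<open>q \<noteq> 0\<close> by (simp add: s_def)
  have A2: "A ^ 2 = (q ^ 2 + q * s) / 2" and B2: "B ^ 2 = (q ^ 2 - q * s) / 2"
    using AB W q2 by simp_all
  have "(1 + 4 * r 0) ^ 3 + (1 + 4 * r 1) ^ 3 + (1 + 4 * r 2) ^ 3 + (1 + 4 * r 3) ^ 3
      = 24 * q * (A ^ 2 - B ^ 2)"
    unfolding r by (simp add: power3_eq_cube power2_eq_square field_simps)
  then have "p * ((p - 1) * M + 1) = p ^ 3 + (p - 1) / 4 * (24 * (p * s))"
    using sum3 W q2 by (simp add: power2_eq_square)
  \<comment> \<open>The third moment is linear in \<open>M\<close> and in \<open>s\<close>, with
    common factor \<open>p * (p - 1)\<close>.\<close>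
  then have "p * (p - 1) * (M - (p + 1 + 6 * s)) = 0"
    by (simp add: field_simps power3_eq_cube)
  then have M: "M = p + 1 + 6 * s" using assms(1,2) by simp
  have "p * s ^ 2 = (A ^ 2 - B ^ 2) ^ 2" using W q2 by (simp add: power_mult_distrib)
  also have "\<dots> \<le> (A ^ 2 + B ^ 2) ^ 2"
    using zero_le_power2[of "A * B"] by (simp add: power2_eq_square algebra_simps)
  finally have "p * s ^ 2 \<le> p * p" unfolding AB by (simp add: power2_eq_square)
  then have s2: "s ^ 2 \<le> p" using assms(1) by simp
  \<comment> \<open>Only even powers of \<open>A\<close> and \<open>B\<close> survive the summation,
    so \<open>A2\<close> and \<open>B2\<close> eliminate them in favour of \<open>q\<close> and
    \<open>s\<close>.\<close>
  have "64 * (r 0 ^ 4 + r 1 ^ 4 + r 2 ^ 4 + r 3 ^ 4)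
      = q ^ 4 + 6 * q ^ 2 + 1 + 12 * (q ^ 2 + 1) * (A ^ 2 + B ^ 2) - 24 * q * (A ^ 2 - B ^ 2)
        + 8 * ((A ^ 2) ^ 2 + (B ^ 2) ^ 2)"
    unfolding r by (simp add: power4_eq_xxxx power2_eq_square field_simps)
  also have "\<dots> = 17 * (q ^ 2) ^ 2 + 4 * q ^ 2 * s ^ 2 - 24 * q ^ 2 * s + 18 * q ^ 2 + 1"
    unfolding A2 B2 by (simp add: power4_eq_xxxx power2_eq_square field_simps)
  finally show ?thesis using that[OF M s2] q2 by simp
qed

section \<open>The formula for \<open>V4\<close> and its bounds\<close>

theorem theorem3p2:
  fixes p g :: nat and t0 :: real
  assumes "prime p" and "[p = 1] (mod 8)"
    and "residue_primroot p g"
    and "real (M000 p) = 16 * t0 + 12"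
  shows "V4 p g = 1 / 576 * (256 * real p * t0 ^ 2 - (32 * real p ^ 2 + 224 * real p) * t0
           + real p ^ 3 + 167 * real p ^ 2 - 113 * real p + 9) \<and>
         1 / 64 * (17 * real p ^ 2 - 18 * real p + 1) \<le> V4 p g \<and>
         V4 p g \<le> 1 / 64 * (21 * real p ^ 2 + 24 * real p powr (3 / 2) + 18 * real p + 1)"
proof -
  note prim = assms(1,3)
  have "1 < p" using assms(1) prime_gt_1_nat by blast
  have dvd8: "8 dvd p - 1"
    using assms(2) \<open>1 < p\<close> by (simp add: cong_altdef_nat)
  have dvd: "2 * 4 dvd p - 1" "4 dvd p - 1" "2 * 2 dvd p - 1"
    using dvd8 by (auto intro: dvd_trans[OF _ dvd8])
  define r where "r s = Re (gauss_period 4 p g s)" for s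
  have gp: "gauss_period 4 p g s = of_real (r s)" for s
    using cnj_gauss_period[OF prim dvd(1), of s] by (simp add: r_def complex_eq_iff)
  have gp2: "gauss_period 2 p g s = of_real (r s + r (s + 2))" for s
    using gauss_period_double[OF dvd(3), of g s] by (simp add: gp)
  have "complex_of_real (\<Sum>s<4. r s) = of_real (-1)"
    using sum_gauss_periods[OF prim dvd(2)] by (simp add: gp)
  then have sum1: "r 0 + r 1 + r 2 + r 3 = -1"
    by (simp only: of_real_eq_iff) (simp add: eval_nat_numeral)
  have "complex_of_real (\<Sum>s<2. (1 + 2 * (r s + r (s + 2))) ^ 2) = of_real (2 * real p)"
    using sum_square_gauss_periods[OF prim dvd(3)] by (simp add: gp2)
  then have quad: "(1 + 2 * (r 0 + r 2)) ^ 2 + (1 + 2 * (r 1 + r 3)) ^ 2 = 2 * real p"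
    by (simp only: of_real_eq_iff) (simp add: eval_nat_numeral)
  have "complex_of_real (\<Sum>s<4. (1 + 4 * r s) ^ 2) = of_real (12 * real p)"
    using sum_square_gauss_periods[OF prim dvd(1)] by (simp add: gp)
  then have sum2: "(1 + 4 * r 0) ^ 2 + (1 + 4 * r 1) ^ 2 + (1 + 4 * r 2) ^ 2 + (1 + 4 * r 3) ^ 2
      = 12 * real p"
    by (simp only: of_real_eq_iff) (simp add: eval_nat_numeral)
  have quarter: "real ((p - 1) div 4) = (real p - 1) / 4"
    using dvd(2) \<open>1 < p\<close> by (simp add: real_of_nat_div of_nat_diff)
  \<comment> \<open>Third moment in two ways: the solution count on the left, the term
    \<open>a = 0\<close> and the periods on the right.\<close>
  have "complex_of_real (real p * real ((p - 1) * M000 p + 1))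
      = of_real (real p ^ 3 + real ((p - 1) div 4) * (\<Sum>s<4. (1 + 4 * r s) ^ 3))"
    using sum_cube_power_exp_sum[of p 4] \<open>1 < p\<close>
      sum_power_exp_sum_primroot[OF prim dvd(2), of "\<lambda>z. z * z * cnj z"]
    unfolding M000_eq_affine_count[OF assms(1)]
    by (simp add: gp power3_eq_cube)
  then have "real p * ((real p - 1) * real (M000 p) + 1)
      = real p ^ 3 + (real p - 1) / 4 * (\<Sum>s<4. (1 + 4 * r s) ^ 3)"
    using \<open>1 < p\<close> unfolding of_real_eq_iff quarter by (simp add: of_nat_diff add.commute)
  also have "(\<Sum>s<4. (1 + 4 * r s) ^ 3)
      = (1 + 4 * r 0) ^ 3 + (1 + 4 * r 1) ^ 3 + (1 + 4 * r 2) ^ 3 + (1 + 4 * r 3) ^ 3"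
    by (simp add: eval_nat_numeral)
  finally obtain s where s: "real (M000 p) = real p + 1 + 6 * s" "s ^ 2 \<le> real p"
    "64 * (r 0 ^ 4 + r 1 ^ 4 + r 2 ^ 4 + r 3 ^ 4)
      = 17 * real p ^ 2 + 4 * real p * s ^ 2 - 24 * real p * s + 18 * real p + 1"
    using fourth_moment_of_periods[OF _ _ sum1 quad sum2] \<open>1 < p\<close> by force
  have "V4 p g = (\<Sum>s<4. r s ^ 4)" by (simp add: V4_def gp)
  also have "\<dots> = r 0 ^ 4 + r 1 ^ 4 + r 2 ^ 4 + r 3 ^ 4"
    by (simp add: lessThan_nat_numeral lessThan_Suc)
  finally have V4: "V4 p g
      = (17 * real p ^ 2 + 4 * real p * s ^ 2 - 24 * real p * s + 18 * real p + 1) / 64"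
    using s(3) by simp
  have s_eq: "s = (16 * t0 + 11 - real p) / 6" using s(1) assms(4) by simp
  have "V4 p g = 1 / 576 * (256 * real p * t0 ^ 2 - (32 * real p ^ 2 + 224 * real p) * t0
           + real p ^ 3 + 167 * real p ^ 2 - 113 * real p + 9)"
    unfolding V4 s_eq by (simp add: power2_eq_square power3_eq_cube field_simps)
  moreover have "1 / 64 * (17 * real p ^ 2 - 18 * real p + 1) \<le> V4 p g"
  proof -
    \<comment> \<open>Completing the square in \<open>s\<close> costs \<open>36 * p\<close>, which
      turns \<open>18 * p\<close> into \<open>- 18 * p\<close>.\<close>
    have "0 \<le> 4 * real p * (s - 3) ^ 2" by simp
    then show ?thesis unfolding V4 by (simp add: power2_eq_square algebra_simps)
  qed
  moreover have "V4 p g \<le> 1 / 64 * (21 * real p ^ 2 + 24 * real p powr (3 / 2) + 18 * real p + 1)"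
  proof -
    \<comment> \<open>The two terms in \<open>s\<close> are bounded separately: the quadratic one
      raises 17 to 21, the linear one gives the power 3/2.\<close>
    have "\<bar>s\<bar> \<le> sqrt (real p)" using s(2) by (metis real_sqrt_abs real_sqrt_le_iff)
    then have "- s \<le> sqrt (real p)" by linarith
    then have "real p * - s \<le> real p * sqrt (real p)"
      by (intro mult_left_mono) auto
    moreover have "real p * s ^ 2 \<le> real p * real p"
      using s(2) by (intro mult_left_mono) auto
    moreover have "real p powr (3 / 2) = real p * sqrt (real p)"
      using \<open>1 < p\<close> powr_add[of "real p" 1 "1 / 2"] by (simp add: powr_half_sqrt)
    ultimately show ?thesis unfolding V4 by (simp add: power2_eq_square)
  qed
  ultimately show ?thesis by blast
qed

end
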